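(* Let $\mathcal{X}$ be a complex separable Hilbert space and $(\Omega,\mu)$ a measure space with positive measure $\mu$. Let $\Xi=\{\Xi_\omega\}_{\omega\in\Omega}$ be a Riesz basis for $\mathcal{X}$ with frame operator $\mathcal{T}_\Xi$, and let $\{\Phi_\omega\}_{\omega\in\Omega}$ be a family in $\mathcal{X}$. The following statements are equivalent: (i) $(\{\Xi_\omega\}_{\omega\in\Omega},\{\Phi_\omega\}_{\omega\in\Omega})$ is a continuous biframe for $\mathcal{X}$. (ii) $\{\Phi_\omega\}_{\omega\in\Omega}=\{(\mathcal{T}_\Xi\mathcal{Q})^{-1}\Xi_\omega\}_{\omega\in\Omega}$ for some $\mathcal{Q}\in B^{+}_{b,b}(\mathcal{X})$. Moreover, if (i) or (ii) is satisfied, then $\{\Phi_\omega\}_{\omega\in\Omega}$ is a Riesz basis for $\mathcal{X}$.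
   Context: A Riesz basis for $\mathcal{X}$ is a family $\{Ue_\omega\}_{\omega\in\Omega}$ with $\{e_\omega\}_{\omega\in\Omega}$ an orthonormal basis of $\mathcal{X}$ and $U$ an invertible bounded linear operator on $\mathcal{X}$. The frame operator is $\mathcal{T}_\Xi\xi=\int_\Omega\langle\xi,\Xi_\omega\rangle\Xi_\omega\,d\mu(\omega)$. A pair $(\Xi,\Phi)$ of weakly measurable families ($\omega\mapsto\langle\xi,\Xi_\omega\rangle$ and $\omega\mapsto\langle\xi,\Phi_\omega\rangle$ measurable for every $\xi$) is a continuous biframe for $\mathcal{X}$ if there are $C,D>0$ with $C\|\xi\|^2\le\int_\Omega\langle\xi,\Xi_\omega\rangle\langle\Phi_\omega,\xi\rangle\,d\mu(\omega)\le D\|\xi\|^2$ for all $\xi\in\mathcal{X}$. $B^{+}_{b,b}(\mathcal{X})$ is the set of positive bounded operators on $\mathcal{X}$ that are bounded below (equivalently, positive invertible bounded operators).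
   Formalization: The Riesz basis Ξ is also assumed to be a continuous frame for μ, so that its frame operator is bounded and invertible; without this the claim fails, e.g. Ξ_n = e_n, μ({n}) = 1/n, Φ_n = n e_n satisfies (i) but Φ is not a Riesz basis. *)

theory Defs
  imports "HOL-Analysis.Analysis" "HOL-Library.Complex_Order"
begin

section \<open>Complex Hilbert spaces\<close>

text \<open>
  A complex inner product space is a real inner product space with a compatible complex scalar
  multiplication and a complex inner product whose real part is the given real one. Positive
  definiteness and the relation with the norm are therefore inherited from \<^class>\<open>real_inner\<close>.
  The complex inner product is linear in its first argument.
\<close>

class complex_inner = real_inner +
  fixes scaleC :: "complex \<Rightarrow> 'a \<Rightarrow> 'a" (infixr "*\<^sub>C" 75)
    and cinner :: "'a \<Rightarrow> 'a \<Rightarrow> complex"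
  assumes scaleC_add_right: "c *\<^sub>C (x + y) = c *\<^sub>C x + c *\<^sub>C y"
    and scaleC_add_left: "(c + d) *\<^sub>C x = c *\<^sub>C x + d *\<^sub>C x"
    and scaleC_scaleC: "c *\<^sub>C (d *\<^sub>C x) = (c * d) *\<^sub>C x"
    and scaleC_of_real: "complex_of_real r *\<^sub>C x = r *\<^sub>R x"
    and cinner_commute: "cinner x y = cnj (cinner y x)"
    and cinner_add_left: "cinner (x + y) z = cinner x z + cinner y z"
    and cinner_scaleC_left: "cinner (c *\<^sub>C x) y = c * cinner x y"
    and Re_cinner: "Re (cinner x y) = inner x y"

class chilbert_space = complex_inner + banach

global_interpretation complex_vector: vector_space "scaleC :: complex \<Rightarrow> 'a \<Rightarrow> 'a :: complex_inner"
  defines cspan = complex_vector.span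
proof unfold_locales
  show "1 *\<^sub>C x = x" for x :: 'a
    using scaleC_of_real[of 1 x] by simp
qed (rule scaleC_add_right scaleC_add_left scaleC_scaleC)+

definition bounded_clinear :: "('a::complex_inner \<Rightarrow> 'a) \<Rightarrow> bool" where
  "bounded_clinear T \<longleftrightarrow> bounded_linear T \<and> (\<forall>c x. T (c *\<^sub>C x) = c *\<^sub>C T x)"

definition invertible_bounded_clinear :: "('a::complex_inner \<Rightarrow> 'a) \<Rightarrow> bool" where
  "invertible_bounded_clinear T \<longleftrightarrow>
     bounded_clinear T \<and> (\<exists>S. bounded_clinear S \<and> S \<circ> T = id \<and> T \<circ> S = id)"

text \<open>
  The order on \<^typ>\<open>complex\<close> is that of \<^theory>\<open>HOL-Library.Complex_Order\<close>: comparable numbers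
  have equal imaginary parts, so positivity below includes that the inner product is real.
\<close>

definition Bplus_bb :: "('a::complex_inner \<Rightarrow> 'a) set" where
  "Bplus_bb = {Q. bounded_clinear Q \<and> (\<forall>x. 0 \<le> cinner (Q x) x)
                 \<and> (\<exists>m>0. \<forall>x. m * norm x \<le> norm (Q x))}"


section \<open>Riesz bases, continuous frames and biframes\<close>

definition orthonormal_basis :: "'w set \<Rightarrow> ('w \<Rightarrow> 'a::complex_inner) \<Rightarrow> bool" where
  "orthonormal_basis \<Omega> e \<longleftrightarrow>
     (\<forall>v\<in>\<Omega>. \<forall>w\<in>\<Omega>. cinner (e v) (e w) = (if v = w then 1 else 0)) \<and>
     closure (cspan (e ` \<Omega>)) = UNIV"

definition riesz_basis :: "'w set \<Rightarrow> ('w \<Rightarrow> 'a::complex_inner) \<Rightarrow> bool" where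
  "riesz_basis \<Omega> \<Xi> \<longleftrightarrow>
     (\<exists>e U. orthonormal_basis \<Omega> e \<and> invertible_bounded_clinear U \<and> (\<forall>w\<in>\<Omega>. \<Xi> w = U (e w)))"

definition weakly_measurable_family :: "'w measure \<Rightarrow> ('w \<Rightarrow> 'a::complex_inner) \<Rightarrow> bool" where
  "weakly_measurable_family M \<Xi> \<longleftrightarrow> (\<forall>\<xi>. (\<lambda>w. cinner \<xi> (\<Xi> w)) \<in> borel_measurable M)"

definition continuous_frame :: "'w measure \<Rightarrow> ('w \<Rightarrow> 'a::complex_inner) \<Rightarrow> bool" where
  "continuous_frame M \<Xi> \<longleftrightarrow> weakly_measurable_family M \<Xi> \<and>
     (\<exists>A>0. \<exists>B>0. \<forall>\<xi>. integrable M (\<lambda>w. (cmod (cinner \<xi> (\<Xi> w)))\<^sup>2) \<and>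
        A * (norm \<xi>)\<^sup>2 \<le> (LINT w|M. (cmod (cinner \<xi> (\<Xi> w)))\<^sup>2) \<and>
        (LINT w|M. (cmod (cinner \<xi> (\<Xi> w)))\<^sup>2) \<le> B * (norm \<xi>)\<^sup>2)"

text \<open>
  Vector-valued integrals are taken in the weak sense. The Bochner integral would not do: even
  for an orthonormal basis and counting measure, the expansion of a vector need not converge
  absolutely.
\<close>

definition has_weak_integral :: "'w measure \<Rightarrow> ('w \<Rightarrow> 'a::complex_inner) \<Rightarrow> 'a \<Rightarrow> bool" where
  "has_weak_integral M f x \<longleftrightarrow>
     (\<forall>\<eta>. integrable M (\<lambda>w. cinner (f w) \<eta>) \<and> (LINT w|M. cinner (f w) \<eta>) = cinner x \<eta>)"

definition weak_integral :: "'w measure \<Rightarrow> ('w \<Rightarrow> 'a::complex_inner) \<Rightarrow> 'a" where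
  "weak_integral M f = (THE x. has_weak_integral M f x)"

definition frame_operator :: "'w measure \<Rightarrow> ('w \<Rightarrow> 'a::complex_inner) \<Rightarrow> 'a \<Rightarrow> 'a" where
  "frame_operator M \<Xi> \<xi> = weak_integral M (\<lambda>w. cinner \<xi> (\<Xi> w) *\<^sub>C \<Xi> w)"

definition continuous_biframe ::
  "'w measure \<Rightarrow> ('w \<Rightarrow> 'a::complex_inner) \<Rightarrow> ('w \<Rightarrow> 'a) \<Rightarrow> bool" where
  "continuous_biframe M \<Xi> \<Phi> \<longleftrightarrow> weakly_measurable_family M \<Xi> \<and> weakly_measurable_family M \<Phi> \<and>
     (\<exists>C>0. \<exists>D>0. \<forall>\<xi>. integrable M (\<lambda>w. cinner \<xi> (\<Xi> w) * cinner (\<Phi> w) \<xi>) \<and>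
        complex_of_real (C * (norm \<xi>)\<^sup>2) \<le> (LINT w|M. cinner \<xi> (\<Xi> w) * cinner (\<Phi> w) \<xi>) \<and>
        (LINT w|M. cinner \<xi> (\<Xi> w) * cinner (\<Phi> w) \<xi>) \<le> complex_of_real (D * (norm \<xi>)\<^sup>2))"

end

theory Submission
  imports Defs
begin

text \<open>
  Polarising the biframe condition turns it into a bounded coercive sesquilinear form, so by the
  Riesz representation theorem there is a positive invertible operator \<open>G\<close> with
  \<open>G \<xi> = \<integral> \<langle>\<xi>, \<Xi>\<^sub>w\<rangle> \<Phi>\<^sub>w d\<mu>(w)\<close> weakly; the frame operator \<open>T\<close> is the case \<open>\<Phi> = \<Xi>\<close>.
  If \<open>f\<^sub>v\<close> is the family biorthogonal to the Riesz basis, then \<open>w \<mapsto> \<langle>f\<^sub>v, \<Xi>\<^sub>w\<rangle>\<close> is the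
  indicator of \<open>{v}\<close>, so \<open>T f\<^sub>v = \<mu>{v} \<Xi>\<^sub>v\<close>,
  \<open>G f\<^sub>v = \<mu>{v} \<Phi>\<^sub>v\<close>. Since \<open>T\<close> is injective, \<open>\<mu>{v} \<noteq> 0\<close>, and \<open>\<Phi>\<^sub>v = G T\<^sup>-\<^sup>1 \<Xi>\<^sub>v\<close>, which is (ii) with
  \<open>Q = G\<^sup>-\<^sup>1\<close>. Conversely, if \<open>\<Phi>\<^sub>w = (T Q)\<^sup>-\<^sup>1 \<Xi>\<^sub>w\<close> then self-adjointness of \<open>T\<close> and \<open>Q\<close> gives
  \<open>\<integral> \<langle>\<xi>, \<Xi>\<^sub>w\<rangle> \<langle>\<Phi>\<^sub>w, \<xi>\<rangle> d\<mu>(w) = \<langle>\<xi>, Q\<^sup>-\<^sup>1 \<xi>\<rangle>\<close>.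
\<close>

section \<open>Positive sesquilinear forms\<close>

lemma cinner_add_right: "cinner x (y + z) = cinner x y + cinner x z"
  by (metis cinner_add_left cinner_commute complex_cnj_add)

lemma cinner_scaleC_right: "cinner x (c *\<^sub>C y) = cnj c * cinner x y"
  by (metis cinner_commute cinner_scaleC_left complex_cnj_mult)

lemma cinner_self: "cinner x x = complex_of_real ((norm x)\<^sup>2)"
proof -
  have "Im (cinner x x) = 0"
    using arg_cong[OF cinner_commute[of x x], of Im] by simp
  then show ?thesis
    by (simp add: complex_eq_iff Re_cinner power2_norm_eq_inner)
qed

lemma cinner_eqI:
  assumes "\<And>z. cinner x z = cinner y z"
  shows "x = y"
proof -
  have "inner x z = inner y z" for z
    using assms[of z] by (metis Re_cinner)
  then have "inner (x - y) (x - y) = 0"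
    by (simp add: inner_diff_left)
  then show ?thesis
    by simp
qed

lemma cinner_zero_left: "cinner 0 x = 0"
  using cinner_scaleC_left[of 0 0 x] by simp

lemma cmod_cinner_square:
  "complex_of_real ((cmod (cinner x y))\<^sup>2) = cinner x y * cinner y x"
  by (metis cinner_commute complex_norm_square)

text \<open>Semidefinite only, so that a single Cauchy-Schwarz inequality serves the inner product,
  the forms \<open>cinner (T x) y\<close> of positive operators, and the form of a biframe.\<close>

locale positive_form =
  fixes b :: "'a::complex_inner \<Rightarrow> 'a \<Rightarrow> complex"
  assumes add_left: "b (x + y) z = b x z + b y z"
    and add_right: "b x (y + z) = b x y + b x z"
    and scale_left: "b (c *\<^sub>C x) y = c * b x y"
    and scale_right: "b x (c *\<^sub>C y) = cnj c * b x y"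
    and nonneg: "0 \<le> b x x"
begin

text \<open>Diagonal values are real. At \<open>x + y\<close> this gives opposite imaginary parts of
  \<open>b x y\<close> and \<open>b y x\<close>, at \<open>x + \<i> *\<^sub>C y\<close> equal real
  parts.\<close>

lemma hermitian: "b y x = cnj (b x y)"
proof -
  have diag: "Im (b z z) = 0" for z
    using nonneg[of z] by (simp add: less_eq_complex_def)
  have "Im (b x y + b y x) = 0"
    using diag[of "x + y"] diag[of x] diag[of y] by (simp add: add_left add_right)
  moreover have "Re (b x y) = Re (b y x)"
    using diag[of "x + \<i> *\<^sub>C y"] diag[of x] diag[of y]
    by (simp add: add_left add_right scale_left scale_right)
  ultimately show ?thesis
    by (simp add: complex_eq_iff)
qed

lemma Re_nonneg: "0 \<le> Re (b x x)"
  using nonneg[of x] by (simp add: less_eq_complex_def)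

text \<open>Nonnegativity along the line \<open>x - t c y\<close> with \<open>t\<close> real: the
  factor \<open>c\<close> makes both cross terms real and leaves a quadratic in \<open>t\<close>. As
  \<open>b\<close> may degenerate, the case of a vanishing diagonal value at \<open>y\<close> is
  treated apart.\<close>

lemma cauchy_schwarz: "(cmod (b x y))\<^sup>2 \<le> Re (b x x) * Re (b y y)"
proof -
  define c where "c = b x y"
  have quadratic: "0 \<le> Re (b x x) - 2 * t * (cmod c)\<^sup>2 + t\<^sup>2 * (cmod c)\<^sup>2 * Re (b y y)" for t
  proof -
    define s where "s = complex_of_real (- t) * c"
    have yy: "b y y = complex_of_real (Re (b y y))"
      using nonneg[of y] by (simp add: less_eq_complex_def complex_eq_iff)
    have "b (x + s *\<^sub>C y) (x + s *\<^sub>C y)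
        = b x x + cnj s * c + s * cnj c + s * cnj s * b y y"
      using hermitian[of y x] by (simp add: add_left add_right scale_left scale_right c_def algebra_simps)
    also have "cnj s * c = complex_of_real (- t * (cmod c)\<^sup>2)"
      unfolding s_def of_real_mult complex_norm_square by simp
    also have "s * cnj c = complex_of_real (- t * (cmod c)\<^sup>2)"
      unfolding s_def of_real_mult complex_norm_square by simp
    also have "s * cnj s = complex_of_real (t\<^sup>2 * (cmod c)\<^sup>2)"
      unfolding s_def of_real_mult complex_norm_square by (simp add: power2_eq_square)
    finally have "Re (b (x + s *\<^sub>C y) (x + s *\<^sub>C y))
        = Re (b x x) - 2 * t * (cmod c)\<^sup>2 + t\<^sup>2 * (cmod c)\<^sup>2 * Re (b y y)"
      by (subst (asm) yy) (simp flip: of_real_mult of_real_power)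
    then show ?thesis
      using Re_nonneg by metis
  qed
  show ?thesis
  proof (cases "Re (b y y) = 0")
    case True
    have "(cmod c)\<^sup>2 = 0"
    proof (rule ccontr)
      assume "(cmod c)\<^sup>2 \<noteq> 0"
      \<comment> \<open>The chosen \<open>t\<close> brings the now affine expression down to
        -1.\<close>
      then show False
        using quadratic[of "(Re (b x x) + 1) / (2 * (cmod c)\<^sup>2)"] True by simp
    qed
    then show ?thesis
      using True by (simp add: c_def)
  next
    case False
    then have pos: "Re (b y y) > 0"
      using Re_nonneg[of y] by simp
    \<comment> \<open>The value \<open>t = 1 / Re (b y y)\<close> minimises the quadratic.\<close>
    then have "0 \<le> Re (b x x) - (cmod c)\<^sup>2 / Re (b y y)"
      using quadratic[of "1 / Re (b y y)"] by (simp add: power2_eq_square)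
    then show ?thesis
      using pos by (simp add: c_def field_simps)
  qed
qed

end

lemma positive_form_cinner: "positive_form cinner"
  by unfold_locales
    (simp_all add: cinner_add_left cinner_add_right cinner_scaleC_left cinner_scaleC_right
      cinner_self less_eq_complex_def)

lemma cmod_cinner_le: "cmod (cinner x y) \<le> norm x * norm y"
  using positive_form.cauchy_schwarz[OF positive_form_cinner, of x y]
  by (simp add: cinner_self flip: power_mult_distrib)

section \<open>Riesz representation and coercive operators\<close>

text \<open>The representing vector is the minimiser of \<open>\<parallel>x\<parallel>\<^sup>2 - 2 \<phi> x\<close>.\<close>

lemma riesz_representation_real:
  fixes \<phi> :: "'a::{real_inner,banach} \<Rightarrow> real"
  assumes "bounded_linear \<phi>"
  shows "\<exists>x. \<forall>y. \<phi> y = inner x y"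
proof -
  interpret \<phi>: bounded_linear \<phi> by fact
  obtain K where K: "K > 0" "\<And>x. norm (\<phi> x) \<le> norm x * K"
    using \<phi>.pos_bounded by blast
  define J where "J x = (norm x)\<^sup>2 - 2 * \<phi> x" for x
  define I where "I = Inf (range J)"
  have lower: "- K\<^sup>2 \<le> J x" for x
  proof -
    have "0 \<le> (norm x - K)\<^sup>2" by simp
    then show ?thesis
      using K(2)[of x] by (simp add: J_def power2_diff abs_le_iff)
  qed
  then have "bdd_below (range J)"
    by (intro bdd_belowI2)
  then have I_le: "I \<le> J x" for x
    unfolding I_def by (intro cInf_lower) auto
  have "\<exists>x. J x < I + inverse (real (Suc n))" for n
    using cInf_lessD[of "range J" "I + inverse (real (Suc n))"] by (auto simp: I_def)
  then obtain X where X: "\<And>n. J (X n) < I + inverse (real (Suc n))"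
    by metis
  \<comment> \<open>The linear terms of \<open>J\<close> cancel, leaving the parallelogram law; it
    makes a minimising sequence Cauchy.\<close>
  have parallelogram: "(norm (x - y))\<^sup>2 = 2 * J x + 2 * J y - 4 * J ((1/2) *\<^sub>R (x + y))" for x y
    by (simp add: J_def \<phi>.scaleR \<phi>.add power2_norm_eq_inner inner_simps inner_commute
        power_divide algebra_simps)
  have "Cauchy X"
  proof (rule metric_CauchyI)
    fix e :: real assume "e > 0"
    \<comment> \<open>Each of the two values of \<open>J\<close> exceeds \<open>I\<close> by less
      than \<open>e\<^sup>2 / 4\<close>, and the midpoint value is at least \<open>I\<close>, so the
      squared distance stays below \<open>e\<^sup>2\<close>.\<close>
    then obtain N where N: "inverse (real (Suc N)) < e\<^sup>2 / 4"
      using reals_Archimedean[of "e\<^sup>2 / 4"] by auto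
    have "dist (X m) (X n) < e" if "m \<ge> N" "n \<ge> N" for m n
    proof -
      have "inverse (real (Suc m)) \<le> inverse (real (Suc N))"
        "inverse (real (Suc n)) \<le> inverse (real (Suc N))"
        using that by (intro le_imp_inverse_le; simp)+
      then have "(dist (X m) (X n))\<^sup>2 < e\<^sup>2"
        using parallelogram[of "X m" "X n"] I_le[of "(1/2) *\<^sub>R (X m + X n)"] X[of m] X[of n] N
        unfolding dist_norm by linarith
      then show ?thesis
        using \<open>e > 0\<close> by (simp add: power2_less_imp_less)
    qed
    then show "\<exists>N. \<forall>m\<ge>N. \<forall>n\<ge>N. dist (X m) (X n) < e"
      by blast
  qed
  then obtain x where x: "X \<longlonglongrightarrow> x"
    using Cauchy_convergent convergent_def by blast
  have "(\<lambda>n. J (X n)) \<longlonglongrightarrow> J x"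
    unfolding J_def by (intro tendsto_intros \<phi>.tendsto x)
  moreover have "(\<lambda>n. I + inverse (real (Suc n))) \<longlonglongrightarrow> I + 0"
    by (intro tendsto_intros LIMSEQ_inverse_real_of_nat)
  ultimately have "J x \<le> I + 0"
    using X by (intro LIMSEQ_le) (auto intro!: exI[of _ 0] less_imp_le)
  then have minimal: "J x \<le> J z" for z
    using I_le[of z] by simp
  have "\<phi> y = inner x y" for y
  proof -
    define d where "d = inner x y - \<phi> y"
    \<comment> \<open>Adding 1 keeps the step \<open>t = - d / n\<close> meaningful for
      \<open>y = 0\<close>.\<close>
    define n where "n = (norm y)\<^sup>2 + 1"
    have n: "n \<ge> 1" by (simp add: n_def)
    have quadratic: "0 \<le> t\<^sup>2 * (norm y)\<^sup>2 + 2 * t * d" for t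
      using minimal[of "x + t *\<^sub>R y"]
      unfolding J_def power2_norm_eq_inner
      by (simp add: \<phi>.scaleR \<phi>.add inner_simps inner_commute d_def algebra_simps
          power2_eq_square[of t] del: dot_square_norm)
    have "0 \<le> (- d / n)\<^sup>2 * n + 2 * (- d / n) * d"
      by (rule order_trans[OF quadratic[of "- d / n"]])
        (intro add_right_mono mult_left_mono; simp add: n_def)
    also have "\<dots> = - (d\<^sup>2 / n)"
      using n by (simp add: power2_eq_square field_simps)
    finally have "d\<^sup>2 \<le> 0"
      using n by (simp add: divide_le_0_iff)
    then show ?thesis
      by (simp add: d_def)
  qed
  then show ?thesis
    by blast
qed

text \<open>As a function of its second argument \<open>cinner\<close> is conjugate-linear, hence
  the form of \<open>scale\<close>. The real part is represented first; evaluating it at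
  \<open>\<i> *\<^sub>C y\<close> recovers the imaginary part.\<close>

lemma riesz_representation_complex:
  fixes F :: "'a::chilbert_space \<Rightarrow> complex"
  assumes add: "\<And>x y. F (x + y) = F x + F y"
    and scale: "\<And>c x. F (c *\<^sub>C x) = cnj c * F x"
    and bound: "\<And>x. cmod (F x) \<le> norm x * K"
  shows "\<exists>x. \<forall>y. F y = cinner x y"
proof -
  have "bounded_linear (\<lambda>x. Re (F x))"
  proof (rule bounded_linear_intro)
    show "Re (F (r *\<^sub>R x)) = r *\<^sub>R Re (F x)" for r x
      using scale[of "complex_of_real r" x] by (simp add: scaleC_of_real)
    show "norm (Re (F x)) \<le> norm x * K" for x
      using bound[of x] abs_Re_le_cmod[of "F x"] by simp
  qed (simp add: add)
  then obtain x where x: "\<And>y. Re (F y) = inner x y"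
    using riesz_representation_real by blast
  have "F y = cinner x y" for y
  proof (rule complex_eqI)
    show "Re (F y) = Re (cinner x y)"
      by (simp add: x Re_cinner)
    have "Re (F (\<i> *\<^sub>C y)) = Re (cinner x (\<i> *\<^sub>C y))"
      by (simp add: x Re_cinner)
    then show "Im (F y) = Im (cinner x y)"
      by (simp add: scale cinner_scaleC_right)
  qed
  then show ?thesis
    by blast
qed

text \<open>For small \<open>t > 0\<close> the map \<open>x \<mapsto> x - t (T x - y)\<close> is a contraction.\<close>

lemma coercive_imp_surj:
  fixes T :: "'a::{real_inner,banach} \<Rightarrow> 'a"
  assumes "bounded_linear T" and c: "c > 0" and coercive: "\<And>x. c * (norm x)\<^sup>2 \<le> inner (T x) x"
  shows "surj T"
proof -
  interpret T: bounded_linear T by fact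
  obtain K0 where K0: "\<And>x. norm (T x) \<le> norm x * K0"
    using T.bounded by blast
  \<comment> \<open>The maximum ensures \<open>K > 0\<close> and \<open>c \<le> K\<close>, so that
    the square root in \<open>q\<close> is real.\<close>
  define K where "K = max K0 c"
  have K: "norm (T x) \<le> norm x * K" for x
    by (rule order_trans[OF K0]) (simp add: K_def mult_left_mono)
  have cK: "c \<le> K" "K > 0" using c by (auto simp: K_def)
  \<comment> \<open>This \<open>t\<close> minimises \<open>1 - 2 t c + t\<^sup>2 K\<^sup>2\<close>;
    the minimum is \<open>q\<^sup>2\<close>.\<close>
  define t where "t = c / K\<^sup>2"
  define q where "q = sqrt (1 - c\<^sup>2 / K\<^sup>2)"
  have ratio: "0 < c\<^sup>2 / K\<^sup>2" "c\<^sup>2 / K\<^sup>2 \<le> 1"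
    using c cK by (simp_all add: power_mono)
  then have q: "0 \<le> q" "q < 1" "q\<^sup>2 = 1 - c\<^sup>2 / K\<^sup>2"
    by (simp_all add: q_def)
  have t: "t > 0" using c cK by (simp add: t_def)
  have contraction: "norm (x - t *\<^sub>R T x) \<le> q * norm x" for x
  proof (rule power2_le_imp_le)
    have "(norm (x - t *\<^sub>R T x))\<^sup>2 = (norm x)\<^sup>2 - 2 * t * inner (T x) x + t\<^sup>2 * (norm (T x))\<^sup>2"
      unfolding power2_norm_eq_inner
      by (simp add: inner_simps inner_commute algebra_simps power2_eq_square[of t] del: dot_square_norm)
    also have "\<dots> \<le> (norm x)\<^sup>2 - 2 * t * (c * (norm x)\<^sup>2) + t\<^sup>2 * (norm x * K)\<^sup>2"
      using coercive[of x] K[of x] t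
      by (intro add_mono diff_mono mult_left_mono power_mono) auto
    also have "\<dots> = (q * norm x)\<^sup>2"
      using cK unfolding power_mult_distrib q(3) t_def by (simp add: field_simps power2_eq_square)
    finally show "(norm (x - t *\<^sub>R T x))\<^sup>2 \<le> (q * norm x)\<^sup>2" .
  qed (use q in simp)
  have "\<exists>x. T x = y" for y
  proof -
    define f where "f x = x - t *\<^sub>R (T x - y)" for x
    have "dist (f u) (f v) \<le> q * dist u v" for u v
    proof -
      have "f u - f v = (u - v) - t *\<^sub>R T (u - v)"
        by (simp add: f_def T.diff algebra_simps)
      then show ?thesis
        using contraction[of "u - v"] by (simp add: dist_norm)
    qed
    then have "\<exists>!x. f x = x"
      using banach_fix_type[of q f] q by blast
    then obtain x where "f x = x"
      by blast
    then show ?thesis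
      using t by (auto simp: f_def)
  qed
  then show ?thesis
    by (metis surjI)
qed

section \<open>Bounded complex-linear operators\<close>

lemma bounded_clinear_comp:
  assumes "bounded_clinear S" "bounded_clinear T"
  shows "bounded_clinear (S \<circ> T)"
  using assms bounded_linear_compose[of S T] by (auto simp: bounded_clinear_def comp_def)

lemma invertible_bounded_clinear_comp:
  assumes "invertible_bounded_clinear S" "invertible_bounded_clinear T"
  shows "invertible_bounded_clinear (S \<circ> T)"
proof -
  from assms obtain S' T' where
    S': "bounded_clinear S'" "S' \<circ> S = id" "S \<circ> S' = id" and
    T': "bounded_clinear T'" "T' \<circ> T = id" "T \<circ> T' = id"
    by (auto simp: invertible_bounded_clinear_def)
  have "(T' \<circ> S') \<circ> (S \<circ> T) = id" "(S \<circ> T) \<circ> (T' \<circ> S') = id"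
    using S' T' by (simp_all add: fun_eq_iff)
  with assms S' T' show ?thesis
    unfolding invertible_bounded_clinear_def by (meson bounded_clinear_comp)
qed

lemma invertible_bounded_clinear_inv:
  assumes "invertible_bounded_clinear T"
  shows "bij T" "invertible_bounded_clinear (inv T)"
proof -
  from assms obtain S where S: "bounded_clinear S" "S \<circ> T = id" "T \<circ> S = id"
    by (auto simp: invertible_bounded_clinear_def)
  then show "bij T"
    using o_bij by blast
  have "inv T = S"
    using S by (metis inv_unique_comp)
  then show "invertible_bounded_clinear (inv T)"
    using assms S by (auto simp: invertible_bounded_clinear_def)
qed

lemma bounded_below_surj_imp_invertible:
  assumes T: "bounded_clinear T" and "surj T" and m: "m > 0"
    and below: "\<And>x. m * norm x \<le> norm (T x)"
  shows "invertible_bounded_clinear T"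
proof -
  interpret T: bounded_linear T
    using T by (simp add: bounded_clinear_def)
  have scale: "T (c *\<^sub>C x) = c *\<^sub>C T x" for c x
    using T by (simp add: bounded_clinear_def)
  have "inj T"
  proof (rule injI)
    fix x y assume "T x = T y"
    then have "m * norm (x - y) \<le> 0"
      using below[of "x - y"] by (simp add: T.diff)
    then show "x = y"
      using m by (simp add: mult_le_0_iff)
  qed
  then have left: "inv T (T x) = x" for x
    by simp
  have right: "T (inv T y) = y" for y
    using \<open>surj T\<close> by (simp add: surj_f_inv_f)
  have "bounded_linear (inv T)"
  proof (rule bounded_linear_intro)
    show "inv T (x + y) = inv T x + inv T y" for x y
      by (metis left right T.add)
    show "inv T (r *\<^sub>R x) = r *\<^sub>R inv T x" for r x
      by (metis left right T.scaleR)
    show "norm (inv T x) \<le> norm x * (1 / m)" for x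
      using below[of "inv T x"] m by (simp add: right field_simps)
  qed
  moreover have "inv T (c *\<^sub>C x) = c *\<^sub>C inv T x" for c x
    by (metis left right scale)
  ultimately show ?thesis
    using T left right unfolding invertible_bounded_clinear_def bounded_clinear_def fun_eq_iff
    by (intro conjI exI[of _ "inv T"]) auto
qed

lemma coercive_imp_bounded_below:
  assumes "c * (norm x)\<^sup>2 \<le> Re (cinner (T x) x)"
  shows "c * norm x \<le> norm (T x)"
proof (cases "x = 0")
  case False
  have "c * norm x * norm x \<le> norm (T x) * norm x"
    using assms complex_Re_le_cmod[of "cinner (T x) x"] cmod_cinner_le[of "T x" x]
    by (simp add: power2_eq_square)
  then show ?thesis
    using False by simp
qed simp

lemma coercive_imp_invertible:
  fixes T :: "'a::chilbert_space \<Rightarrow> 'a"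
  assumes "bounded_clinear T" "c > 0" "\<And>x. c * (norm x)\<^sup>2 \<le> Re (cinner (T x) x)"
  shows "invertible_bounded_clinear T"
proof (rule bounded_below_surj_imp_invertible)
  show "surj T"
    using assms by (intro coercive_imp_surj[of T c]) (auto simp: bounded_clinear_def Re_cinner)
qed (use assms coercive_imp_bounded_below in auto)

section \<open>Positive operators and operators of positive forms\<close>

lemma positive_form_operator:
  assumes T: "bounded_clinear T" and "\<And>x. 0 \<le> cinner (T x) x"
  shows "positive_form (\<lambda>x y. cinner (T x) y)"
proof -
  interpret T: bounded_linear T
    using T by (simp add: bounded_clinear_def)
  show ?thesis
    using assms
    by unfold_locales
      (simp_all add: bounded_clinear_def T.add cinner_add_left cinner_add_right
        cinner_scaleC_left cinner_scaleC_right)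
qed

text \<open>Over the complex numbers a real diagonal already forces hermitian symmetry of the form
  \<open>cinner (T x) y\<close>.\<close>

lemma positive_operator_self_adjoint:
  assumes "bounded_clinear T" and "\<And>x. 0 \<le> cinner (T x) x"
  shows "cinner (T x) y = cinner x (T y)"
  using positive_form.hermitian[OF positive_form_operator[OF assms], of x y]
  by (metis cinner_commute)

text \<open>Cauchy-Schwarz for the form of \<open>T\<close> at the pair \<open>x\<close>,
  \<open>T x\<close>. Applied to \<open>Q\<close> at \<open>inv Q \<xi>\<close>, it yields the lower
  biframe bound.\<close>

lemma positive_operator_norm_le:
  assumes "bounded_clinear T" and "\<And>x. 0 \<le> cinner (T x) x" and K: "\<And>x. norm (T x) \<le> norm x * K"
  shows "(norm (T x))\<^sup>2 \<le> K * Re (cinner (T x) x)"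
proof (cases "T x = 0")
  case False
  interpret form: positive_form "\<lambda>x y. cinner (T x) y"
    by (rule positive_form_operator) fact+
  let ?r = "Re (cinner (T x) x)"
  have "((norm (T x))\<^sup>2)\<^sup>2 = (cmod (cinner (T x) (T x)))\<^sup>2"
    by (simp add: cinner_self norm_power)
  also have "\<dots> \<le> ?r * Re (cinner (T (T x)) (T x))"
    by (rule form.cauchy_schwarz)
  also have "\<dots> \<le> ?r * (norm (T x) * K * norm (T x))"
  proof (intro mult_left_mono form.Re_nonneg)
    have "Re (cinner (T (T x)) (T x)) \<le> norm (T (T x)) * norm (T x)"
      using complex_Re_le_cmod cmod_cinner_le order_trans by blast
    also have "\<dots> \<le> norm (T x) * K * norm (T x)"
      by (intro mult_right_mono K) simp
    finally show "Re (cinner (T (T x)) (T x)) \<le> norm (T x) * K * norm (T x)" .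
  qed
  finally have "(norm (T x))\<^sup>2 * (norm (T x))\<^sup>2 \<le> (K * ?r) * (norm (T x))\<^sup>2"
    by (simp add: power2_eq_square mult_ac)
  then show ?thesis
    by (rule mult_right_le_imp_le) (use False in simp)
qed (simp add: cinner_zero_left)

text \<open>
  \<open>Q\<close> is not assumed coercive, but \<open>Q \<circ> Q\<close> is, because
  \<open>\<langle>Q\<^sup>2 x, x\<rangle> = \<parallel>Q x\<parallel>\<^sup>2\<close>.
\<close>

lemma Bplus_bb_invertible:
  fixes Q :: "'a::chilbert_space \<Rightarrow> 'a"
  assumes "Q \<in> Bplus_bb"
  shows "invertible_bounded_clinear Q"
proof -
  from assms obtain m where Q: "bounded_clinear Q" "\<And>x. 0 \<le> cinner (Q x) x"
    and m: "m > 0" "\<And>x. m * norm x \<le> norm (Q x)"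
    by (auto simp: Bplus_bb_def)
  have "invertible_bounded_clinear (Q \<circ> Q)"
  proof (rule coercive_imp_invertible)
    show "m\<^sup>2 * (norm x)\<^sup>2 \<le> Re (cinner ((Q \<circ> Q) x) x)" for x
    proof -
      have "m\<^sup>2 * (norm x)\<^sup>2 = (m * norm x)\<^sup>2"
        by (simp add: power_mult_distrib)
      also have "\<dots> \<le> (norm (Q x))\<^sup>2"
        using m by (intro power_mono) auto
      also have "\<dots> = Re (cinner ((Q \<circ> Q) x) x)"
        by (simp add: positive_operator_self_adjoint[OF Q] cinner_self)
      finally show ?thesis .
    qed
  qed (use Q m in \<open>auto intro: bounded_clinear_comp\<close>)
  then have "surj (Q \<circ> Q)"
    using invertible_bounded_clinear_inv(1) bij_is_surj by blast
  then have "surj Q"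
    by (force simp: surj_def)
  then show ?thesis
    using bounded_below_surj_imp_invertible Q(1) m by blast
qed

text \<open>With \<open>y = inv G x\<close>, the value \<open>cinner (inv G x) x\<close> equals
  \<open>cinner (G y) y\<close>, so positivity transfers. The norm bound of \<open>G\<close> becomes
  the lower bound of \<open>inv G\<close>.\<close>

lemma inv_positive_in_Bplus_bb:
  assumes G: "invertible_bounded_clinear G" and pos: "\<And>x. 0 \<le> cinner (G x) x"
  shows "inv G \<in> Bplus_bb"
proof -
  have right: "G (inv G x) = x" for x
    using invertible_bounded_clinear_inv(1)[OF G] by (simp add: bij_is_surj surj_f_inv_f)
  have bG: "bounded_clinear G"
    using G by (simp add: invertible_bounded_clinear_def)
  have "0 \<le> cinner (inv G x) x" for x
    using pos[of "inv G x"] positive_operator_self_adjoint[OF bG pos, of "inv G x" "inv G x"]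
    by (simp add: right)
  moreover obtain K where K: "K > 0" "\<And>x. norm (G x) \<le> norm x * K"
    using bG bounded_linear.pos_bounded unfolding bounded_clinear_def by blast
  then have "\<exists>m>0. \<forall>x. m * norm x \<le> norm (inv G x)"
    using K(2)[of "inv G _"] by (intro exI[of _ "1 / K"]) (simp add: right field_simps)
  ultimately show ?thesis
    using invertible_bounded_clinear_inv(2)[OF G]
    by (simp add: Bplus_bb_def invertible_bounded_clinear_def)
qed

text \<open>Cauchy-Schwarz extends the diagonal bound to all pairs, so each \<open>b x\<close> is a
  bounded conjugate-linear functional, and its representing vector is taken as
  \<open>G x\<close>.\<close>

lemma bounded_form_operator:
  fixes b :: "'a::chilbert_space \<Rightarrow> 'a \<Rightarrow> complex"
  assumes "positive_form b" and D: "D \<ge> 0" and bound: "\<And>x. Re (b x x) \<le> D * (norm x)\<^sup>2"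
  shows "\<exists>G. bounded_clinear G \<and> (\<forall>x y. cinner (G x) y = b x y)"
proof -
  interpret positive_form b by fact
  have b_le: "cmod (b x y) \<le> D * norm x * norm y" for x y
  proof (rule power2_le_imp_le)
    have "(cmod (b x y))\<^sup>2 \<le> Re (b x x) * Re (b y y)"
      by (rule cauchy_schwarz)
    also have "\<dots> \<le> (D * (norm x)\<^sup>2) * (D * (norm y)\<^sup>2)"
      using D by (intro mult_mono bound Re_nonneg) auto
    finally show "(cmod (b x y))\<^sup>2 \<le> (D * norm x * norm y)\<^sup>2"
      by (simp add: power2_eq_square mult_ac)
  qed (use D in simp)
  have "\<exists>z. \<forall>y. b x y = cinner z y" for x
    by (rule riesz_representation_complex[where K = "D * norm x"])
      (use b_le[of x] in \<open>simp_all add: add_right scale_right mult_ac\<close>)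
  then obtain G where G: "\<And>x y. b x y = cinner (G x) y"
    by metis
  have "bounded_linear G"
  proof (rule bounded_linear_intro)
    show "G (x + y) = G x + G y" for x y
      by (rule cinner_eqI) (simp add: cinner_add_left add_left flip: G)
    show "G (r *\<^sub>R x) = r *\<^sub>R G x" for r x
      by (rule cinner_eqI) (simp add: cinner_scaleC_left scale_left flip: G scaleC_of_real)
    show "norm (G x) \<le> norm x * D" for x
    proof (cases "G x = 0")
      case False
      have "norm (G x) * norm (G x) \<le> (norm x * D) * norm (G x)"
        using b_le[of x "G x"]
        by (simp add: G cinner_self norm_power power2_eq_square norm_mult mult_ac)
      then show ?thesis
        using False by simp
    qed (use D in simp)
  qed
  moreover have "G (c *\<^sub>C x) = c *\<^sub>C G x" for c x
    by (rule cinner_eqI) (simp add: cinner_scaleC_left scale_left flip: G)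
  ultimately show ?thesis
    using G unfolding bounded_clinear_def by metis
qed

section \<open>The operator of a biframe\<close>

lemma has_weak_integral_unique:
  assumes "has_weak_integral M f x" "has_weak_integral M f y"
  shows "x = y"
  using assms by (intro cinner_eqI) (metis has_weak_integral_def)

lemma weak_integral_eq:
  assumes "has_weak_integral M f x"
  shows "weak_integral M f = x"
  unfolding weak_integral_def using assms has_weak_integral_unique by (intro the_equality) blast+

lemma biframe_operator:
  fixes \<Xi> \<Phi> :: "'w \<Rightarrow> 'a::chilbert_space"
  assumes "continuous_biframe M \<Xi> \<Phi>"
  shows "\<exists>G. invertible_bounded_clinear G \<and> (\<forall>\<xi>. 0 \<le> cinner (G \<xi>) \<xi>) \<and>
      (\<forall>\<xi>. has_weak_integral M (\<lambda>w. cinner \<xi> (\<Xi> w) *\<^sub>C \<Phi> w) (G \<xi>))"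
proof -
  define p where "p x y w = cinner x (\<Xi> w) * cinner (\<Phi> w) y" for x y w
  from assms obtain C D where C: "C > 0" and D: "D > 0"
    and diag: "\<And>x. integrable M (p x x)"
    and lower: "\<And>x. complex_of_real (C * (norm x)\<^sup>2) \<le> (LINT w|M. p x x w)"
    and upper: "\<And>x. (LINT w|M. p x x w) \<le> complex_of_real (D * (norm x)\<^sup>2)"
    unfolding continuous_biframe_def p_def by blast
  define b where "b x y = (LINT w|M. p x y w)" for x y
  have p_add_left: "p (x + y) z w = p x z w + p y z w" for x y z w
    by (simp add: p_def cinner_add_left algebra_simps)
  have p_add_right: "p x (y + z) w = p x y w + p x z w" for x y z w
    by (simp add: p_def cinner_add_right algebra_simps)
  have p_scale_left: "p (c *\<^sub>C x) y w = c * p x y w" for c x y w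
    by (simp add: p_def cinner_scaleC_left)
  have p_scale_right: "p x (c *\<^sub>C y) w = cnj c * p x y w" for c x y w
    by (simp add: p_def cinner_scaleC_right)
  have int: "integrable M (p x y)" for x y
  proof -
    \<comment> \<open>Integrability is given on the diagonal only; the four-term polarisation
      identity carries it to all pairs.\<close>
    have polarization: "p x y w = (p (x + y) (x + y) w - p (x + (-1) *\<^sub>C y) (x + (-1) *\<^sub>C y) w
        + \<i> * p (x + \<i> *\<^sub>C y) (x + \<i> *\<^sub>C y) w
        - \<i> * p (x + (-\<i>) *\<^sub>C y) (x + (-\<i>) *\<^sub>C y) w) / 4" for w
      unfolding p_add_left p_add_right p_scale_left p_scale_right
      by (simp add: algebra_simps)
    have "integrable M (\<lambda>w. (p (x + y) (x + y) w - p (x + (-1) *\<^sub>C y) (x + (-1) *\<^sub>C y) w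
        + \<i> * p (x + \<i> *\<^sub>C y) (x + \<i> *\<^sub>C y) w
        - \<i> * p (x + (-\<i>) *\<^sub>C y) (x + (-\<i>) *\<^sub>C y) w) / 4)"
      by (intro Bochner_Integration.integrable_add Bochner_Integration.integrable_diff
          integrable_divide integrable_mult_right diag)
    then show ?thesis
      unfolding polarization[symmetric] .
  qed
  have b_lower: "C * (norm x)\<^sup>2 \<le> Re (b x x)" and b_real: "Im (b x x) = 0"
    and b_upper: "Re (b x x) \<le> D * (norm x)\<^sup>2" for x
    using lower[of x] upper[of x] by (simp_all add: b_def less_eq_complex_def)
  have b_nonneg: "0 \<le> b x x" for x
    using b_real[of x] order_trans[OF _ b_lower[of x], of 0] C by (simp add: less_eq_complex_def)
  have "positive_form b"
  proof unfold_locales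
    show "b (x + y) z = b x z + b y z" for x y z
      unfolding b_def p_add_left by (rule Bochner_Integration.integral_add) (rule int)+
    show "b x (y + z) = b x y + b x z" for x y z
      unfolding b_def p_add_right by (rule Bochner_Integration.integral_add) (rule int)+
    show "b (c *\<^sub>C x) y = c * b x y" "b x (c *\<^sub>C y) = cnj c * b x y" for c x y
      by (simp_all add: b_def p_scale_left p_scale_right)
  qed (rule b_nonneg)
  then obtain G where G: "bounded_clinear G" "\<And>x y. cinner (G x) y = b x y"
    using bounded_form_operator[of b D] D b_upper by auto
  have "invertible_bounded_clinear G"
    using coercive_imp_invertible[of G C] G C b_lower by simp
  moreover have "has_weak_integral M (\<lambda>w. cinner x (\<Xi> w) *\<^sub>C \<Phi> w) (G x)" for x
    using int[of x] G(2)[of x] unfolding has_weak_integral_def cinner_scaleC_left b_def p_def by simp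
  ultimately show ?thesis
    using G b_nonneg by auto
qed

text \<open>Pairing \<open>\<Xi>\<close> with itself gives the squared modulus as integrand, so
  \<open>biframe_operator\<close> also covers the frame operator.\<close>

lemma continuous_frame_imp_biframe:
  assumes "continuous_frame M \<Xi>"
  shows "continuous_biframe M \<Xi> \<Xi>"
proof -
  have eq: "(\<lambda>w. cinner \<xi> (\<Xi> w) * cinner (\<Xi> w) \<xi>)
      = (\<lambda>w. complex_of_real ((cmod (cinner \<xi> (\<Xi> w)))\<^sup>2))" for \<xi>
    by (simp only: cmod_cinner_square)
  show ?thesis
    using assms unfolding continuous_frame_def continuous_biframe_def eq
    by (simp add: less_eq_complex_def complex_of_real_integrable_eq del: of_real_power of_real_mult)
qed

text \<open>Uniqueness of weak integrals identifies the definite description in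
  \<open>frame_operator\<close> with the operator supplied by
  \<open>biframe_operator\<close>.\<close>

lemma continuous_frame_operator:
  fixes \<Xi> :: "'w \<Rightarrow> 'a::chilbert_space"
  assumes "continuous_frame M \<Xi>"
  defines "T \<equiv> frame_operator M \<Xi>"
  shows "invertible_bounded_clinear T"
    and "0 \<le> cinner (T \<xi>) \<xi>"
    and "has_weak_integral M (\<lambda>w. cinner \<xi> (\<Xi> w) *\<^sub>C \<Xi> w) (T \<xi>)"
proof -
  obtain G where G: "invertible_bounded_clinear G" "\<And>\<xi>. 0 \<le> cinner (G \<xi>) \<xi>"
      "\<And>\<xi>. has_weak_integral M (\<lambda>w. cinner \<xi> (\<Xi> w) *\<^sub>C \<Xi> w) (G \<xi>)"
    using biframe_operator[OF continuous_frame_imp_biframe[OF assms(1)]] by auto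
  have "T = G"
    unfolding T_def frame_operator_def using weak_integral_eq[OF G(3)] by blast
  with G show "invertible_bounded_clinear T" "0 \<le> cinner (T \<xi>) \<xi>"
      "has_weak_integral M (\<lambda>w. cinner \<xi> (\<Xi> w) *\<^sub>C \<Xi> w) (T \<xi>)"
    by simp_all
qed

section \<open>Riesz bases\<close>

text \<open>The orthonormal basis stays and \<open>V \<circ> U\<close> replaces
  \<open>U\<close>.\<close>

lemma riesz_basis_image:
  assumes "riesz_basis \<Omega> \<Xi>" "invertible_bounded_clinear V" "\<And>w. w \<in> \<Omega> \<Longrightarrow> \<Phi> w = V (\<Xi> w)"
  shows "riesz_basis \<Omega> \<Phi>"
proof -
  from assms(1) obtain e U where "orthonormal_basis \<Omega> e" "invertible_bounded_clinear U"
      "\<And>w. w \<in> \<Omega> \<Longrightarrow> \<Xi> w = U (e w)"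
    by (auto simp: riesz_basis_def)
  then show ?thesis
    unfolding riesz_basis_def using assms(2,3)
    by (intro exI[of _ e] exI[of _ "V \<circ> U"]) (simp add: invertible_bounded_clinear_comp)
qed

text \<open>The vector \<open>f\<close> is the adjoint of \<open>inv U\<close> applied to
  \<open>e v\<close>, obtained by representing the functional that sends \<open>y\<close> to
  \<open>cinner (e v) (inv U y)\<close>.\<close>

lemma riesz_basis_biorthogonal:
  fixes \<Xi> :: "'w \<Rightarrow> 'a::chilbert_space"
  assumes "riesz_basis \<Omega> \<Xi>" "v \<in> \<Omega>"
  shows "\<exists>f. \<forall>w\<in>\<Omega>. cinner f (\<Xi> w) = (if w = v then 1 else 0)"
proof -
  from assms obtain e U where e: "orthonormal_basis \<Omega> e" and U: "invertible_bounded_clinear U"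
    and \<Xi>: "\<And>w. w \<in> \<Omega> \<Longrightarrow> \<Xi> w = U (e w)"
    by (auto simp: riesz_basis_def)
  have "bounded_clinear (inv U)"
    using invertible_bounded_clinear_inv(2)[OF U] by (simp add: invertible_bounded_clinear_def)
  then interpret V: bounded_linear "inv U"
    by (simp add: bounded_clinear_def)
  obtain K where K: "\<And>x. norm (inv U x) \<le> norm x * K"
    using V.bounded by blast
  have "\<exists>f. \<forall>y. cinner (e v) (inv U y) = cinner f y"
  proof (rule riesz_representation_complex)
    show "cmod (cinner (e v) (inv U y)) \<le> norm y * (K * norm (e v))" for y
    proof -
      have "cmod (cinner (e v) (inv U y)) \<le> norm (e v) * norm (inv U y)"
        by (rule cmod_cinner_le)
      also have "\<dots> \<le> norm (e v) * (norm y * K)"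
        by (intro mult_left_mono K) simp
      finally show ?thesis
        by (simp add: mult_ac)
    qed
  qed (use \<open>bounded_clinear (inv U)\<close> in
      \<open>simp_all add: V.add cinner_add_right bounded_clinear_def cinner_scaleC_right\<close>)
  then obtain f where f: "\<And>y. cinner f y = cinner (e v) (inv U y)"
    by metis
  have "cinner f (\<Xi> w) = (if w = v then 1 else 0)" if "w \<in> \<Omega>" for w
    using e that \<open>v \<in> \<Omega>\<close> invertible_bounded_clinear_inv(1)[OF U]
    by (auto simp: f \<Xi> bij_is_inj orthonormal_basis_def)
  then show ?thesis
    by blast
qed

text \<open>The integrand collapses to the indicator of \<open>{v}\<close> times
  \<open>\<Phi> v\<close>. By convention \<open>measure M {v}\<close> is 0 when \<open>{v}\<close>
  is not measurable or has infinite measure.\<close>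

lemma has_weak_integral_biorthogonal:
  assumes f: "\<And>w. w \<in> space M \<Longrightarrow> cinner f (\<Xi> w) = (if w = v then 1 else 0)"
    and v: "v \<in> space M"
    and int: "has_weak_integral M (\<lambda>w. cinner f (\<Xi> w) *\<^sub>C \<Phi> w) x"
  shows "x = complex_of_real (measure M {v}) *\<^sub>C \<Phi> v"
proof (rule cinner_eqI)
  fix y
  have eq: "cinner (cinner f (\<Xi> w) *\<^sub>C \<Phi> w) y
      = complex_of_real (indicator {v} w) * cinner (\<Phi> v) y" if "w \<in> space M" for w
    using f[OF that] by (simp add: cinner_scaleC_left)
  have "cinner x y = (LINT w|M. cinner (cinner f (\<Xi> w) *\<^sub>C \<Phi> w) y)"
    using int by (simp add: has_weak_integral_def)
  also have "\<dots> = (LINT w|M. complex_of_real (indicator {v} w) * cinner (\<Phi> v) y)"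
    by (rule Bochner_Integration.integral_cong[OF refl eq])
  also have "\<dots> = complex_of_real (measure M {v}) * cinner (\<Phi> v) y"
    using v by (simp only: integral_mult_left_zero integral_complex_of_real integral_indicator) simp
  finally show "cinner x y = cinner (complex_of_real (measure M {v}) *\<^sub>C \<Phi> v) y"
    by (simp add: cinner_scaleC_left)
qed

section \<open>The two implications and the Riesz basis property\<close>

lemma biframe_imp_inverse_image:
  fixes \<Xi> \<Phi> :: "'w \<Rightarrow> 'a::chilbert_space"
  assumes riesz: "riesz_basis (space M) \<Xi>" and frame: "continuous_frame M \<Xi>"
    and biframe: "continuous_biframe M \<Xi> \<Phi>"
  shows "\<exists>Q\<in>Bplus_bb. \<forall>w\<in>space M. \<Phi> w = inv (frame_operator M \<Xi> \<circ> Q) (\<Xi> w)"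
proof -
  define T where "T = frame_operator M \<Xi>"
  note T = continuous_frame_operator[OF frame, folded T_def]
  obtain G where G: "invertible_bounded_clinear G" "\<And>\<xi>. 0 \<le> cinner (G \<xi>) \<xi>"
      "\<And>\<xi>. has_weak_integral M (\<lambda>w. cinner \<xi> (\<Xi> w) *\<^sub>C \<Phi> w) (G \<xi>)"
    using biframe_operator[OF biframe] by auto
  have bij: "bij T" "bij G" "bij (inv G)"
    using invertible_bounded_clinear_inv T(1) G(1) by (auto intro: bij_imp_bij_inv)
  have "\<Phi> v = inv (T \<circ> inv G) (\<Xi> v)" if v: "v \<in> space M" for v
  proof -
    obtain f where f: "\<And>w. w \<in> space M \<Longrightarrow> cinner f (\<Xi> w) = (if w = v then 1 else 0)"
      using riesz_basis_biorthogonal[OF riesz v] by blast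
    define \<mu> where "\<mu> = complex_of_real (measure M {v})"
    have Tf: "T f = \<mu> *\<^sub>C \<Xi> v"
      unfolding \<mu>_def by (rule has_weak_integral_biorthogonal[OF f v T(3)])
    have Gf: "G f = \<mu> *\<^sub>C \<Phi> v"
      unfolding \<mu>_def by (rule has_weak_integral_biorthogonal[OF f v G(3)])
    have scale: "T (c *\<^sub>C x) = c *\<^sub>C T x" "G (c *\<^sub>C x) = c *\<^sub>C G x" for c x
      using T(1) G(1) by (simp_all add: invertible_bounded_clinear_def bounded_clinear_def)
    \<comment> \<open>The vector \<open>f\<close> is nonzero, since its product with
      \<open>\<Xi> v\<close> is 1, and \<open>T\<close> is injective. This also rules out the
      default value 0 of \<open>measure\<close>.\<close>
    have "\<mu> \<noteq> 0"
    proof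
      assume "\<mu> = 0"
      then have "T f = T (0 *\<^sub>C f)"
        unfolding scale by (simp add: Tf)
      then have "f = 0 *\<^sub>C f"
        using bij(1) by (meson bij_is_inj injD)
      then have "cinner f (\<Xi> v) = 0"
        by (metis cinner_scaleC_left mult_zero_left)
      then show False
        using f[OF v] by simp
    qed
    \<comment> \<open>After division by \<open>\<mu>\<close> one vector is sent to
      \<open>\<Xi> v\<close> by \<open>T\<close> and to \<open>\<Phi> v\<close> by \<open>G\<close>,
      so \<open>T \<circ> inv G\<close> takes \<open>\<Phi> v\<close> to
      \<open>\<Xi> v\<close>.\<close>
    then have "T (inverse \<mu> *\<^sub>C f) = \<Xi> v" "G (inverse \<mu> *\<^sub>C f) = \<Phi> v"
      by (simp_all add: scale Tf Gf)
    then have "(T \<circ> inv G) (\<Phi> v) = \<Xi> v"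
      using bij(2) by (metis bij_is_inj comp_apply inv_f_f)
    moreover have "inj (T \<circ> inv G)"
      using bij by (simp add: bij_comp bij_is_inj)
    ultimately show ?thesis
      by (metis inv_f_f)
  qed
  then show ?thesis
    using inv_positive_in_Bplus_bb[OF G(1,2)] unfolding T_def by blast
qed

lemma inverse_image_imp_biframe:
  fixes \<Xi> \<Phi> :: "'w \<Rightarrow> 'a::chilbert_space"
  assumes frame: "continuous_frame M \<Xi>" and "Q \<in> Bplus_bb"
    and \<Phi>: "\<And>w. w \<in> space M \<Longrightarrow> \<Phi> w = inv (frame_operator M \<Xi> \<circ> Q) (\<Xi> w)"
  shows "continuous_biframe M \<Xi> \<Phi>"
proof -
  define T where "T = frame_operator M \<Xi>"
  note T = continuous_frame_operator[OF frame, folded T_def]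
  from assms obtain m where Q: "bounded_clinear Q" "\<And>x. 0 \<le> cinner (Q x) x"
    and m: "m > 0" "\<And>x. m * norm x \<le> norm (Q x)"
    by (auto simp: Bplus_bb_def)
  obtain K where K: "K > 0" "\<And>x. norm (Q x) \<le> norm x * K"
    using Q(1) bounded_linear.pos_bounded unfolding bounded_clinear_def by blast
  have bij: "bij T" "bij Q"
    using T(1) Bplus_bb_invertible[OF \<open>Q \<in> Bplus_bb\<close>] invertible_bounded_clinear_inv(1) by auto
  have TT: "T (inv T x) = x" and QQ: "Q (inv Q x) = x" for x
    using bij by (simp_all add: bij_is_surj surj_f_inv_f)
  have bT: "bounded_clinear T"
    using T(1) by (simp add: invertible_bounded_clinear_def)
  note T_adjoint = positive_operator_self_adjoint[OF bT T(2)]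
  note Q_adjoint = positive_operator_self_adjoint[OF Q]
  \<comment> \<open>Self-adjointness moves both inverses onto \<open>\<xi>\<close>. The biframe
    integral thereby becomes the weak integral for \<open>T \<xi>\<close> tested against the fixed
    vector \<open>inv T (inv Q \<xi>)\<close>.\<close>
  have \<Phi>_inner: "cinner (\<Phi> w) \<xi> = cinner (\<Xi> w) (inv T (inv Q \<xi>))" if "w \<in> space M" for w \<xi>
  proof -
    have "\<Phi> w = inv Q (inv T (\<Xi> w))"
      using \<Phi>[OF that] o_inv_distrib[OF bij] by (simp add: T_def)
    then have "\<Xi> w = T (Q (\<Phi> w))"
      by (simp add: TT QQ)
    then show ?thesis
      by (simp add: T_adjoint Q_adjoint TT QQ)
  qed
  have prod_eq: "cinner \<xi> (\<Xi> w) * cinner (\<Phi> w) \<xi>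
      = cinner (cinner \<xi> (\<Xi> w) *\<^sub>C \<Xi> w) (inv T (inv Q \<xi>))" if "w \<in> space M" for w \<xi>
    by (simp add: \<Phi>_inner[OF that] cinner_scaleC_left)
  have int: "integrable M (\<lambda>w. cinner \<xi> (\<Xi> w) * cinner (\<Phi> w) \<xi>)" for \<xi>
    using T(3)[of \<xi>] by (simp add: has_weak_integral_def prod_eq cong: Bochner_Integration.integrable_cong)
  have val: "(LINT w|M. cinner \<xi> (\<Xi> w) * cinner (\<Phi> w) \<xi>) = cinner \<xi> (inv Q \<xi>)" for \<xi>
  proof -
    have "(LINT w|M. cinner \<xi> (\<Xi> w) * cinner (\<Phi> w) \<xi>) = cinner (T \<xi>) (inv T (inv Q \<xi>))"
      using T(3)[of \<xi>]
      by (simp add: has_weak_integral_def prod_eq cong: Bochner_Integration.integral_cong)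
    then show ?thesis
      by (simp add: T_adjoint TT)
  qed
  have "weakly_measurable_family M \<Phi>"
    unfolding weakly_measurable_family_def
  proof
    fix \<xi>
    have "(\<lambda>w. cinner (inv T (inv Q \<xi>)) (\<Xi> w)) \<in> borel_measurable M"
      using frame by (simp add: continuous_frame_def weakly_measurable_family_def)
    moreover have "cinner \<xi> (\<Phi> w) = cinner (inv T (inv Q \<xi>)) (\<Xi> w)" if "w \<in> space M" for w
      using \<Phi>_inner[OF that] by (metis cinner_commute)
    ultimately show "(\<lambda>w. cinner \<xi> (\<Phi> w)) \<in> borel_measurable M"
      by (simp cong: measurable_cong)
  qed
  moreover have "Im (cinner \<xi> (inv Q \<xi>)) = 0" for \<xi>
    using Q(2)[of "inv Q \<xi>"] by (simp add: QQ less_eq_complex_def)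
  \<comment> \<open>The lower biframe constant comes from the norm bound \<open>K\<close> of
    \<open>Q\<close>, the upper one below from its lower bound \<open>m\<close>.\<close>
  moreover have "(norm \<xi>)\<^sup>2 / K \<le> Re (cinner \<xi> (inv Q \<xi>))" for \<xi>
    using positive_operator_norm_le[OF Q K(2), of "inv Q \<xi>"] K(1) by (simp add: QQ field_simps)
  moreover have "Re (cinner \<xi> (inv Q \<xi>)) \<le> (norm \<xi>)\<^sup>2 / m" for \<xi>
  proof -
    have "Re (cinner \<xi> (inv Q \<xi>)) \<le> norm \<xi> * norm (inv Q \<xi>)"
      using complex_Re_le_cmod cmod_cinner_le order_trans by blast
    also have "\<dots> \<le> norm \<xi> * (norm \<xi> / m)"
      using m(2)[of "inv Q \<xi>"] m(1) by (intro mult_left_mono) (simp_all add: QQ field_simps)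
    finally show ?thesis
      by (simp add: power2_eq_square)
  qed
  moreover have "weakly_measurable_family M \<Xi>"
    using frame by (simp add: continuous_frame_def)
  ultimately show ?thesis
    unfolding continuous_biframe_def val using int K(1) m(1)
    by (intro conjI exI[of _ "1 / K"] exI[of _ "1 / m"] allI)
      (simp_all add: less_eq_complex_def del: of_real_power of_real_mult of_real_divide)
qed

text \<open>The assumption \<open>frame\<close> makes the weak integrals behind
  \<open>frame_operator\<close> exist and the operator invertible; for an arbitrary measure a Riesz
  basis alone does not guarantee this.\<close>

theorem theorem3p20:
  fixes M :: "'w measure" and \<Xi> \<Phi> :: "'w \<Rightarrow> 'a::chilbert_space"
  assumes separable: "separable_space (euclidean :: 'a topology)"
    and riesz: "riesz_basis (space M) \<Xi>"
    and frame: "continuous_frame M \<Xi>"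
  shows "(continuous_biframe M \<Xi> \<Phi> \<longleftrightarrow>
            (\<exists>Q\<in>Bplus_bb. \<forall>w\<in>space M. \<Phi> w = inv (frame_operator M \<Xi> \<circ> Q) (\<Xi> w)))
       \<and> (continuous_biframe M \<Xi> \<Phi> \<or>
            (\<exists>Q\<in>Bplus_bb. \<forall>w\<in>space M. \<Phi> w = inv (frame_operator M \<Xi> \<circ> Q) (\<Xi> w))
          \<longrightarrow> riesz_basis (space M) \<Phi>)"
proof -
  have equiv: "continuous_biframe M \<Xi> \<Phi> \<longleftrightarrow>
      (\<exists>Q\<in>Bplus_bb. \<forall>w\<in>space M. \<Phi> w = inv (frame_operator M \<Xi> \<circ> Q) (\<Xi> w))"
    using biframe_imp_inverse_image[OF riesz frame] inverse_image_imp_biframe[OF frame] by blast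
  have "riesz_basis (space M) \<Phi>"
    if "Q \<in> Bplus_bb" "\<forall>w\<in>space M. \<Phi> w = inv (frame_operator M \<Xi> \<circ> Q) (\<Xi> w)" for Q
    using that continuous_frame_operator(1)[OF frame] Bplus_bb_invertible
    by (intro riesz_basis_image[OF riesz, of "inv (frame_operator M \<Xi> \<circ> Q)"]
        invertible_bounded_clinear_inv(2) invertible_bounded_clinear_comp) auto
  with equiv show ?thesis
    by blast
qed

end
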